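(* Let $U\subset\mathbb{R}^{N+l}\setminus\{0\}$ be open and let $u=u(z)$ be a $C^2$ function on $U$. For $\widetilde z=(\widetilde x,\widetilde y)\in\mathbb{R}^{N+l}\setminus\{0\}$ put $z=z(\widetilde z)=(x,y)$ with $$x=\frac{\widetilde x}{d^2(\widetilde z,0)},\qquad y=\frac{\widetilde y}{d^{2+2\gamma}(\widetilde z,0)},$$ and, whenever $z(\widetilde z)\in U$, define $$w(\widetilde z)=d^{N_\gamma-2}(z,0)\,u(z).$$ Then $$\Delta_\gamma^{(\widetilde z)}w(\widetilde z)=d^{N_\gamma+2}(z,0)\,\Delta_\gamma u(z).$$
   Context: Points of $\mathbb{R}^{N+l}=\mathbb{R}^N\times\mathbb{R}^l$ are written $z=(x,y)$, with $N+l\ge3$; $\gamma\ge0$ is a real number and $N_\gamma=N+(1+\gamma)l$. The Grushin operator is $\Delta_\gamma u=\Delta_xu+|x|^{2\gamma}\Delta_yu$; $\Delta_\gamma^{(\widetilde z)}$ denotes the same operator acting in the variable $\widetilde z=(\widetilde x,\widetilde y)$, i.e. $\Delta_\gamma^{(\widetilde z)}=\Delta_{\widetilde x}+|\widetilde x|^{2\gamma}\Delta_{\widetilde y}$, while $\Delta_\gamma$ acts in the variable $z$. The distance to the origin is $d(z,0)=\left(\frac{1}{(1+\gamma)^2}|x|^{2+2\gamma}+|y|^2\right)^{\frac{1}{2+2\gamma}}$. The map $u\mapsto w$ is called the Kelvin transformation. *)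

theory Defs
  imports "HOL-Analysis.Analysis"
begin

text \<open>Intended for open \<open>U\<close>: the derivatives are full Frechet derivatives.\<close>
definition C2_on :: "'a::real_normed_vector set \<Rightarrow> ('a \<Rightarrow> real) \<Rightarrow> bool" where
  "C2_on U u \<longleftrightarrow>
     (\<exists>(Du :: 'a \<Rightarrow> 'a \<Rightarrow>\<^sub>L real) (D2u :: 'a \<Rightarrow> 'a \<Rightarrow>\<^sub>L ('a \<Rightarrow>\<^sub>L real)).
        (\<forall>z\<in>U. (u has_derivative blinfun_apply (Du z)) (at z)) \<and>
        (\<forall>z\<in>U. (Du has_derivative blinfun_apply (D2u z)) (at z)) \<and>
        continuous_on U D2u)"

definition partial_derivative :: "'a::real_normed_vector \<Rightarrow> ('a \<Rightarrow> real) \<Rightarrow> 'a \<Rightarrow> real" where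
  "partial_derivative v u z = deriv (\<lambda>t::real. u (z + t *\<^sub>R v)) 0"

definition laplacian_x :: "((real ^ 'n) \<times> (real ^ 'l) \<Rightarrow> real) \<Rightarrow> (real ^ 'n) \<times> (real ^ 'l) \<Rightarrow> real" where
  "laplacian_x u z =
     (\<Sum>i\<in>UNIV. partial_derivative (axis i 1, 0) (partial_derivative (axis i 1, 0) u) z)"

definition laplacian_y :: "((real ^ 'n) \<times> (real ^ 'l) \<Rightarrow> real) \<Rightarrow> (real ^ 'n) \<times> (real ^ 'l) \<Rightarrow> real" where
  "laplacian_y u z =
     (\<Sum>j\<in>UNIV. partial_derivative (0, axis j 1) (partial_derivative (0, axis j 1) u) z)"

text \<open>
  The weight is the \<open>2 * \<gamma>\<close>-th power of \<open>norm x\<close>. For \<open>\<gamma> = 0\<close> it is identically 1, including at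
  \<open>x = 0\<close>, whereas \<open>0 powr 0 = 0\<close>.
\<close>
definition grushin_weight :: "real \<Rightarrow> real ^ 'n \<Rightarrow> real" where
  "grushin_weight \<gamma> x = (if \<gamma> = 0 then 1 else norm x powr (2 * \<gamma>))"

definition grushin :: "real \<Rightarrow> ((real ^ 'n) \<times> (real ^ 'l) \<Rightarrow> real) \<Rightarrow> (real ^ 'n) \<times> (real ^ 'l) \<Rightarrow> real" where
  "grushin \<gamma> u z = laplacian_x u z + grushin_weight \<gamma> (fst z) * laplacian_y u z"

definition grushin_dist0 :: "real \<Rightarrow> (real ^ 'n) \<times> (real ^ 'l) \<Rightarrow> real" where
  "grushin_dist0 \<gamma> z =
     (1 / (1 + \<gamma>)\<^sup>2 * norm (fst z) powr (2 + 2 * \<gamma>) + (norm (snd z))\<^sup>2) powr (1 / (2 + 2 * \<gamma>))"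

definition homogeneous_dim :: "nat \<Rightarrow> nat \<Rightarrow> real \<Rightarrow> real" where
  "homogeneous_dim N l \<gamma> = real N + (1 + \<gamma>) * real l"

definition kelvin_point :: "real \<Rightarrow> (real ^ 'n) \<times> (real ^ 'l) \<Rightarrow> (real ^ 'n) \<times> (real ^ 'l)" where
  "kelvin_point \<gamma> z =
     ((1 / (grushin_dist0 \<gamma> z)\<^sup>2) *\<^sub>R fst z,
      (1 / grushin_dist0 \<gamma> z powr (2 + 2 * \<gamma>)) *\<^sub>R snd z)"

text \<open>
  For \<open>u\<close> defined on \<open>U\<close>, the value is meaningful only at points \<open>z' \<noteq> 0\<close> with
  \<open>kelvin_point \<gamma> z' \<in> U\<close>.
\<close>
definition kelvin_transform ::
  "real \<Rightarrow> ((real ^ 'n) \<times> (real ^ 'l) \<Rightarrow> real) \<Rightarrow> (real ^ 'n) \<times> (real ^ 'l) \<Rightarrow> real" where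
  "kelvin_transform \<gamma> u z' =
     grushin_dist0 \<gamma> (kelvin_point \<gamma> z') powr (homogeneous_dim CARD('n) CARD('l) \<gamma> - 2)
       * u (kelvin_point \<gamma> z')"

end

theory Submission
  imports Defs
begin

text \<open>
  Put \<open>p = 1 + \<gamma>\<close>, \<open>R(z) = d(z,0)^(2p)\<close>, \<open>G = |x|^(2\<gamma>)\<close>, \<open>h = G / R\<close> and \<open>Q = N_\<gamma>\<close>. The inversion is
  \<open>K(z) = E_R z\<close> with the anisotropic scaling \<open>E_s (x, y) = (s^(-1/p) x, s^(-1) y)\<close>, and
  \<open>w = R^a (u \<circ> K)\<close> with \<open>a = (2 - Q) / (2p)\<close>. Since \<open>s dE_s/ds = A E_s\<close> for \<open>A = diag(-1/p, -1)\<close>,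
  the derivative of \<open>K\<close> in a coordinate direction \<open>v\<close> is \<open>E_R v + \<sigma> P\<close>, where \<open>\<sigma> = (\<partial>_v R) / R\<close> and
  \<open>P = A K\<close>; differentiating again adds only terms in \<open>\<sigma> A E_R v\<close>, \<open>\<tau> P\<close> and \<open>\<sigma>^2 A P\<close>, where
  \<open>\<tau> = \<partial>_v \<sigma>\<close>. Summed over the coordinate directions with weights \<open>c = 1\<close> in \<open>x\<close> and \<open>c = G\<close> in \<open>y\<close>,
  \<open>\<Sum> c \<sigma>^2 = 4h\<close>, \<open>\<Sum> c \<tau> = (2/p)(Q - 2) h = -4ah\<close> and \<open>\<Sum> c \<sigma> E_R v = -2h P\<close>.
  These three identities cancel every term of \<open>\<Delta>_\<gamma> w\<close> except \<open>R^a \<Sum> c D\<^sup>2u(E_R v, E_R v)\<close>,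
  which equals \<open>R^(a - 2/p) \<Delta>_\<gamma> u\<close> at \<open>K(z)\<close> because \<open>R^(-2/p) G(K(z)) = R^(-2) G(z)\<close>.
\<close>

section \<open>Second derivatives along lines and curves\<close>

text \<open>Translating the parameter identifies the inner partial derivative at
  \<open>z + t *\<^sub>R v\<close> with \<open>g t\<close>. The first derivative is required on a
  neighbourhood of 0, \<open>t = 0\<close> included, because the outer derivative sees the inner one
  only through its germ there.\<close>

lemma second_partial_derivative_eq:
  fixes f :: "'a::real_normed_vector \<Rightarrow> real"
  assumes "\<forall>\<^sub>F t in nhds 0. ((\<lambda>t. f (z + t *\<^sub>R v)) has_real_derivative g t) (at t)"
    and "(g has_real_derivative c) (at 0)"
  shows "partial_derivative v (partial_derivative v f) z = c"
proof -
  have "\<forall>\<^sub>F t in nhds 0. partial_derivative v f (z + t *\<^sub>R v) = g t"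
    using assms(1)
  proof eventually_elim
    case (elim t)
    have "((\<lambda>s. f (z + (s + t) *\<^sub>R v)) has_real_derivative g t) (at 0)"
      using DERIV_shift[of "\<lambda>s. f (z + s *\<^sub>R v)" "g t" 0 t] elim by simp
    then show ?case
      unfolding partial_derivative_def by (intro DERIV_imp_deriv) (simp add: algebra_simps)
  qed
  then have "((\<lambda>t. partial_derivative v f (z + t *\<^sub>R v)) has_real_derivative c) (at 0)"
    using DERIV_cong_ev[OF refl _ refl] assms(2) by fast
  then show ?thesis
    unfolding partial_derivative_def[of v "partial_derivative v f"] by (rule DERIV_imp_deriv)
qed

lemma has_real_derivative_compose_curve:
  assumes "(u has_derivative blinfun_apply D) (at (k t))"
    and "(k has_vector_derivative k') (at t)"
  shows "((\<lambda>t. u (k t)) has_real_derivative blinfun_apply D k') (at t)"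
  unfolding has_field_derivative_def
  by (rule has_derivative_eq_rhs[OF has_derivative_compose[OF
        assms(2)[unfolded has_vector_derivative_def] assms(1)]])
    (simp add: blinfun.scaleR_right fun_eq_iff)

text \<open>Evaluation of a bounded linear map is bilinear, so this is a product rule. With
  \<open>m\<close> the velocity of \<open>k\<close> it yields a Hessian term plus a term in the
  acceleration of \<open>k\<close>.\<close>

lemma has_real_derivative_blinfun_curve:
  fixes Du :: "'a::real_normed_vector \<Rightarrow> 'a \<Rightarrow>\<^sub>L real"
  assumes D: "(Du has_derivative blinfun_apply D2) (at (k t))"
    and k: "(k has_vector_derivative k') (at t)"
    and m: "(m has_vector_derivative m') (at t)"
  shows "((\<lambda>t. Du (k t) (m t)) has_real_derivative D2 k' (m t) + Du (k t) m') (at t)"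
proof -
  have "((\<lambda>t. Du (k t)) has_vector_derivative D2 k') (at t)"
    using has_derivative_compose[OF k[unfolded has_vector_derivative_def] D]
    by (simp add: has_vector_derivative_def blinfun.scaleR_right)
  from bounded_bilinear.has_vector_derivative[OF bounded_bilinear_blinfun_apply this m]
  show ?thesis
    by (simp add: has_real_derivative_iff_has_vector_derivative add.commute)
qed

lemma tendsto_line:
  fixes z :: "'a::real_normed_vector"
  shows "((\<lambda>t. z + t *\<^sub>R v) \<longlongrightarrow> z) (nhds 0)"
  by (auto intro!: tendsto_eq_intros filterlim_ident)

text \<open>A straight line has constant velocity, so the acceleration term vanishes and only the
  Hessian remains.\<close>

lemma second_partial_derivative_C2:
  fixes Du :: "'a::real_normed_vector \<Rightarrow> 'a \<Rightarrow>\<^sub>L real"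
  assumes "open U" "z \<in> U"
    and "\<And>z. z \<in> U \<Longrightarrow> (u has_derivative blinfun_apply (Du z)) (at z)"
    and "(Du has_derivative blinfun_apply D2) (at z)"
  shows "partial_derivative v (partial_derivative v u) z = D2 v v"
proof (rule second_partial_derivative_eq)
  have line: "((\<lambda>t. z + t *\<^sub>R v) has_vector_derivative v) (at t)" for t
    by (auto intro!: derivative_eq_intros)
  have "\<forall>\<^sub>F t in nhds 0. z + t *\<^sub>R v \<in> U"
    using tendsto_line assms(1,2) by (rule topological_tendstoD)
  then show "\<forall>\<^sub>F t in nhds 0. ((\<lambda>t. u (z + t *\<^sub>R v)) has_real_derivative Du (z + t *\<^sub>R v) v) (at t)"
    by eventually_elim (intro has_real_derivative_compose_curve assms line)
  show "((\<lambda>t. Du (z + t *\<^sub>R v) v) has_real_derivative D2 v v) (at 0)"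
    using has_real_derivative_blinfun_curve[of Du D2 "\<lambda>t. z + t *\<^sub>R v" 0 v "\<lambda>t. v" 0]
      assms(4) line by simp
qed

section \<open>The gauge, the anisotropic scaling and its generator\<close>

text \<open>This is \<open>R\<close> of the overview, the distance to the origin without its outer
  root.\<close>

definition grushin_gauge :: "real \<Rightarrow> (real ^ 'n) \<times> (real ^ 'l) \<Rightarrow> real" where
  "grushin_gauge \<gamma> z = 1 / (1 + \<gamma>)\<^sup>2 * norm (fst z) powr (2 + 2 * \<gamma>) + (norm (snd z))\<^sup>2"

text \<open>For \<open>s > 0\<close> this is the Grushin dilation that multiplies x by m and y by
  the power \<open>1 + \<gamma>\<close> of m, where
  \<open>m = s powr (- 1 / (1 + \<gamma>))\<close>. It is the map \<open>E_s\<close> of the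
  overview.\<close>

definition kelvin_scaling :: "real \<Rightarrow> real \<Rightarrow> 'a::real_vector \<times> 'b::real_vector \<Rightarrow> 'a \<times> 'b" where
  "kelvin_scaling \<gamma> s v = (s powr (- 1 / (1 + \<gamma>)) *\<^sub>R fst v, (1 / s) *\<^sub>R snd v)"

text \<open>The matrix \<open>A\<close> of the overview, that is, the logarithmic derivative of
  \<open>kelvin_scaling\<close> in \<open>s\<close>.\<close>

definition kelvin_generator :: "real \<Rightarrow> 'a::real_vector \<times> 'b::real_vector \<Rightarrow> 'a \<times> 'b" where
  "kelvin_generator \<gamma> v = ((- 1 / (1 + \<gamma>)) *\<^sub>R fst v, - snd v)"

lemma linear_kelvin_generator: "linear (kelvin_generator \<gamma>)"
  by (rule linearI) (auto simp: kelvin_generator_def algebra_simps)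

lemma bounded_linear_kelvin_generator:
  "bounded_linear (kelvin_generator \<gamma> :: 'a::euclidean_space \<times> 'b::euclidean_space \<Rightarrow> _)"
  by (simp add: linear_conv_bounded_linear[symmetric] linear_kelvin_generator)

lemma linear_kelvin_scaling: "linear (kelvin_scaling \<gamma> s)"
  by (rule linearI) (auto simp: kelvin_scaling_def algebra_simps)

text \<open>A product rule in which the moving parameter contributes its logarithmic derivative
  times the generator. The vector may move too, so the rule serves both for the image of a line and
  for the scaled direction in its velocity.\<close>

lemma has_vector_derivative_kelvin_scaling:
  fixes v :: "real \<Rightarrow> 'a::euclidean_space \<times> 'b::euclidean_space"
  assumes r: "(r has_real_derivative r') (at t)" and pos: "r t > 0"
    and v: "(v has_vector_derivative v') (at t)"
  shows "((\<lambda>t. kelvin_scaling \<gamma> (r t) (v t)) has_vector_derivative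
           kelvin_scaling \<gamma> (r t) v' + (r' / r t) *\<^sub>R kelvin_generator \<gamma> (kelvin_scaling \<gamma> (r t) (v t))) (at t)"
proof -
  have v1: "((\<lambda>t. fst (v t)) has_vector_derivative fst v') (at t)"
    using v by (rule bounded_linear.has_vector_derivative[OF bounded_linear_fst])
  have v2: "((\<lambda>t. snd (v t)) has_vector_derivative snd v') (at t)"
    using v by (rule bounded_linear.has_vector_derivative[OF bounded_linear_snd])
  have "((\<lambda>t. r t powr (- 1 / (1 + \<gamma>))) has_real_derivative
          (- 1 / (1 + \<gamma>)) * r t powr (- 1 / (1 + \<gamma>)) * (r' / r t)) (at t)"
    using pos by (auto intro!: derivative_eq_intros r simp: powr_diff field_simps)
  from has_vector_derivative_scaleR[OF this v1]
  have 1: "((\<lambda>t. r t powr (- 1 / (1 + \<gamma>)) *\<^sub>R fst (v t)) has_vector_derivative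
     r t powr (- 1 / (1 + \<gamma>)) *\<^sub>R fst v' +
     ((- 1 / (1 + \<gamma>)) * r t powr (- 1 / (1 + \<gamma>)) * (r' / r t)) *\<^sub>R fst (v t)) (at t)" .
  have "((\<lambda>t. 1 / r t) has_real_derivative - (1 / r t) * (r' / r t)) (at t)"
    using pos by (auto intro!: derivative_eq_intros r simp: field_simps)
  from has_vector_derivative_scaleR[OF this v2]
  have 2: "((\<lambda>t. (1 / r t) *\<^sub>R snd (v t)) has_vector_derivative
     (1 / r t) *\<^sub>R snd v' + (- (1 / r t) * (r' / r t)) *\<^sub>R snd (v t)) (at t)" .
  from has_vector_derivative_Pair[OF 1 2] show ?thesis
    unfolding kelvin_scaling_def
    by (simp add: kelvin_generator_def mult.commute mult.left_commute)
qed

section \<open>The inversion as a scaling, and the behaviour of distance and weight under it\<close>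

lemma grushin_gauge_pos:
  assumes "\<gamma> \<ge> 0" "z \<noteq> 0"
  shows "grushin_gauge \<gamma> z > 0"
proof (cases "fst z = 0")
  case True
  then have "snd z \<noteq> 0" using assms by (auto simp: prod_eq_iff)
  then show ?thesis unfolding grushin_gauge_def using True by simp
next
  case False
  then show ?thesis
    unfolding grushin_gauge_def using assms by (intro add_pos_nonneg) auto
qed

lemma kelvin_point_eq:
  assumes "\<gamma> \<ge> 0" "z \<noteq> 0"
  shows "kelvin_point \<gamma> z = kelvin_scaling \<gamma> (grushin_gauge \<gamma> z) z"
proof -
  let ?R = "grushin_gauge \<gamma> z"
  have R: "?R > 0" using grushin_gauge_pos assms by blast
  have d: "grushin_dist0 \<gamma> z = ?R powr (1 / (2 + 2 * \<gamma>))"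
    by (simp add: grushin_dist0_def grushin_gauge_def)
  have "(grushin_dist0 \<gamma> z)\<^sup>2 = ?R powr (1 / (1 + \<gamma>))"
  proof -
    have "1 / (2 + 2 * \<gamma>) + 1 / (2 + 2 * \<gamma>) = 1 / (1 + \<gamma>)"
      using assms by (simp add: divide_simps)
    then show ?thesis unfolding d power2_eq_square by (metis powr_add)
  qed
  moreover have "grushin_dist0 \<gamma> z powr (2 + 2 * \<gamma>) = ?R"
    unfolding d using assms R by (simp add: powr_powr)
  ultimately show ?thesis
    using R by (simp add: kelvin_point_def kelvin_scaling_def powr_minus_divide)
qed

text \<open>Scaling with parameter \<open>s\<close> multiplies the gauge by
  \<open>1 / s\<^sup>2\<close>; for \<open>s\<close> equal to the gauge itself the result is its
  reciprocal. Powers of the distance at the image thus become powers of the gauge at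
  \<open>z\<close>.\<close>

lemma grushin_dist0_kelvin_point:
  assumes "\<gamma> \<ge> 0" "z \<noteq> 0"
  shows "grushin_dist0 \<gamma> (kelvin_point \<gamma> z) = grushin_gauge \<gamma> z powr (- 1 / (2 + 2 * \<gamma>))"
proof -
  let ?R = "grushin_gauge \<gamma> z"
  have R: "?R > 0" using grushin_gauge_pos assms by blast
  have e: "(2 + 2 * \<gamma>) / (1 + \<gamma>) = 2" using assms by (simp add: field_simps)
  have "(?R powr (- 1 / (1 + \<gamma>)) * norm (fst z)) powr (2 + 2 * \<gamma>) =
      ?R powr (-2) * norm (fst z) powr (2 + 2 * \<gamma>)"
    using e by (simp add: powr_mult powr_powr)
  moreover have "?R powr (-2) = 1 / ?R\<^sup>2"
    using R by (simp add: powr_minus_divide)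
  ultimately have "1 / (1 + \<gamma>)\<^sup>2 * norm (fst (kelvin_point \<gamma> z)) powr (2 + 2 * \<gamma>)
       + (norm (snd (kelvin_point \<gamma> z)))\<^sup>2 =
     (1 / ?R\<^sup>2) * (1 / (1 + \<gamma>)\<^sup>2 * norm (fst z) powr (2 + 2 * \<gamma>) + (norm (snd z))\<^sup>2)"
    using R by (simp add: kelvin_point_eq[OF assms] kelvin_scaling_def power_mult_distrib
        power_divide algebra_simps)
  also have "\<dots> = 1 / ?R"
    unfolding grushin_gauge_def[symmetric] using R by (simp add: power2_eq_square)
  finally show ?thesis
    unfolding grushin_dist0_def using R by (simp add: powr_divide powr_minus_divide)
qed

text \<open>The weight is homogeneous of degree \<open>2 * \<gamma>\<close> in x, and the exponents
  add up to -2. Hence the x and y parts of the transformed operator carry the same power of the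
  gauge.\<close>

lemma grushin_weight_kelvin_scaling:
  assumes "\<gamma> \<ge> 0" "s > 0"
  shows "s powr (- 2 / (1 + \<gamma>)) * grushin_weight \<gamma> (fst (kelvin_scaling \<gamma> s z)) =
    grushin_weight \<gamma> (fst z) / s\<^sup>2"
proof -
  have e: "- 2 / (1 + \<gamma>) + (- 1 / (1 + \<gamma>)) * (2 * \<gamma>) = -2"
    using assms by (simp add: divide_simps) (simp add: algebra_simps)
  have s2: "s powr (-2) = 1 / s\<^sup>2"
    using assms by (simp add: powr_minus_divide)
  show ?thesis
  proof (cases "\<gamma> = 0")
    case True
    then show ?thesis using s2 by (simp add: grushin_weight_def)
  next
    case False
    have "s powr (- 2 / (1 + \<gamma>)) * (s powr (- 1 / (1 + \<gamma>)) * norm (fst z)) powr (2 * \<gamma>)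
      = s powr (- 2 / (1 + \<gamma>) + (- 1 / (1 + \<gamma>)) * (2 * \<gamma>)) * norm (fst z) powr (2 * \<gamma>)"
      unfolding powr_add by (simp add: powr_mult powr_powr)
    then show ?thesis
      unfolding e s2 using False by (simp add: grushin_weight_def kelvin_scaling_def)
  qed
qed

section \<open>Derivatives of the norm power and of the weight across \<open>x = 0\<close>\<close>

text \<open>
  The norm is not differentiable at the origin, but its power \<open>2 + 2 * \<gamma>\<close> is; this is what makes the
  Kelvin transformation differentiable on the degeneracy set \<open>x = 0\<close>.
\<close>
lemma has_real_derivative_norm_powr_line:
  fixes x e :: "'a::real_inner"
  assumes "\<gamma> \<ge> 0"
  shows "((\<lambda>t. norm (x + t *\<^sub>R e) powr (2 + 2 * \<gamma>)) has_real_derivative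
    (2 + 2 * \<gamma>) * (if \<gamma> = 0 then 1 else norm (x + t *\<^sub>R e) powr (2 * \<gamma>)) * ((x + t *\<^sub>R e) \<bullet> e)) (at t)"
proof -
  define q where "q t = (x + t *\<^sub>R e) \<bullet> (x + t *\<^sub>R e)" for t
  have q_eq: "q t = (norm (x + t *\<^sub>R e))\<^sup>2" for t
    by (simp add: q_def power2_norm_eq_inner)
  have norm_eq: "norm (x + t *\<^sub>R e) powr (2 * b) = q t powr b" for t b
    by (simp add: q_eq power2_eq_square powr_mult flip: powr_add)
  have q': "(q has_real_derivative 2 * ((x + t *\<^sub>R e) \<bullet> e)) (at t)"
    unfolding q_def[abs_def] has_field_derivative_def
    by (auto intro!: derivative_eq_intros simp: inner_commute algebra_simps fun_eq_iff)
  have lhs: "(\<lambda>t. norm (x + t *\<^sub>R e) powr (2 + 2 * \<gamma>)) = (\<lambda>t. q t powr (1 + \<gamma>))"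
    using norm_eq[of _ "1 + \<gamma>"] by (simp add: algebra_simps)
  show ?thesis
  proof (cases "q t = 0")
    case False
    then have "q t > 0" by (simp add: q_eq)
    then have "((\<lambda>t. q t powr (1 + \<gamma>)) has_real_derivative
       (1 + \<gamma>) * q t powr \<gamma> * (2 * ((x + t *\<^sub>R e) \<bullet> e))) (at t)"
      using DERIV_fun_powr[OF q', of "1 + \<gamma>"] by simp
    then show ?thesis
      unfolding lhs using norm_eq[of t \<gamma>] \<open>q t > 0\<close> by (auto simp: algebra_simps)
  next
    case True
    \<comment> \<open>The line passes through the origin at parameter \<open>t\<close>, so the
      difference quotient is explicit; it tends to 0 because \<open>1 + 2 * \<gamma>\<close> is
      positive.\<close>
    then have x: "x = - t *\<^sub>R e" by (simp add: q_eq eq_neg_iff_add_eq_0)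
    have "((\<lambda>s. norm e powr (2 + 2 * \<gamma>) * (\<bar>s - t\<bar> powr (1 + 2 * \<gamma>) * sgn (s - t))) \<longlongrightarrow> 0) (at t)"
    proof -
      have "((\<lambda>s. norm e powr (2 + 2 * \<gamma>) * \<bar>s - t\<bar> powr (1 + 2 * \<gamma>)) \<longlongrightarrow> 0) (at t)"
        using assms by (auto intro!: tendsto_eq_intros)
      then show ?thesis
        by (rule Lim_null_comparison[rotated]) (auto simp: abs_mult sgn_if)
    qed
    moreover have "(norm (x + s *\<^sub>R e) powr (2 + 2 * \<gamma>) - norm (x + t *\<^sub>R e) powr (2 + 2 * \<gamma>)) / (s - t) =
       norm e powr (2 + 2 * \<gamma>) * (\<bar>s - t\<bar> powr (1 + 2 * \<gamma>) * sgn (s - t))" for s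
    proof -
      have e: "x + s *\<^sub>R e = (s - t) *\<^sub>R e" "x + t *\<^sub>R e = 0"
        by (simp_all add: x algebra_simps)
      have "\<bar>s - t\<bar> powr (2 + 2 * \<gamma>) = \<bar>s - t\<bar> * \<bar>s - t\<bar> powr (1 + 2 * \<gamma>)"
        using powr_mult_base[of "\<bar>s - t\<bar>" "1 + 2 * \<gamma>"] by (simp add: add.assoc[symmetric])
      then have n: "norm (x + s *\<^sub>R e) powr (2 + 2 * \<gamma>) =
          \<bar>s - t\<bar> * \<bar>s - t\<bar> powr (1 + 2 * \<gamma>) * norm e powr (2 + 2 * \<gamma>)"
        unfolding e(1) norm_scaleR powr_mult by simp
      \<comment> \<open>This holds at \<open>s = t\<close> as well, where both sides are 0.\<close>
      have sgn: "sgn (s - t) = \<bar>s - t\<bar> / (s - t)"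
        by (cases "s - t" "0 :: real" rule: linorder_cases) (simp_all add: eq_divide_eq)
      show ?thesis
        unfolding n sgn e(2) by simp
    qed
    ultimately show ?thesis
      by (simp add: has_field_derivative_iff x)
  qed
qed

text \<open>At \<open>x = 0\<close> the quotient is \<open>0 / 0 = 0\<close>, which is the correct value.\<close>
lemma has_real_derivative_weight_line:
  fixes x :: "real ^ 'n"
  assumes "\<gamma> \<ge> 0"
  shows "((\<lambda>t. grushin_weight \<gamma> (x + t *\<^sub>R axis i 1) * (x $ i + t)) has_real_derivative
    grushin_weight \<gamma> x * (1 + 2 * \<gamma> * (x $ i)\<^sup>2 / (norm x)\<^sup>2)) (at 0)"
proof (cases "\<gamma> = 0")
  case True
  then show ?thesis by (auto simp: grushin_weight_def intro!: derivative_eq_intros)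
next
  case \<gamma>: False
  show ?thesis
  proof (cases "x = 0")
    case True
    \<comment> \<open>This power is the difference quotient at \<open>x = 0\<close>, since the axis
      vector has norm 1; the claimed derivative is 0 because the weight vanishes there for
      \<open>\<gamma> > 0\<close>.\<close>
    have "((\<lambda>t. \<bar>t\<bar> powr (2 * \<gamma>)) \<longlongrightarrow> 0) (at 0)"
      using assms \<gamma> by (auto intro!: tendsto_eq_intros)
    then show ?thesis
      using \<gamma> True
      by (auto simp: grushin_weight_def has_field_derivative_iff norm_axis_1
          elim!: Lim_transform_eventually intro!: eventually_at_filter[THEN iffD2] always_eventually)
  next
    case False
    then have n: "norm x > 0" by simp
    have "((\<lambda>t. norm (x + t *\<^sub>R axis i 1)) has_real_derivative (x $ i) / norm x) (at 0)"
    proof -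
      have "((\<lambda>t. norm (x + t *\<^sub>R axis i 1)) has_derivative (\<lambda>t. sgn x \<bullet> (t *\<^sub>R axis i 1))) (at 0)"
      proof -
        have "((\<lambda>t. x + t *\<^sub>R axis i 1) has_derivative (\<lambda>t. t *\<^sub>R axis i 1)) (at 0)"
          by (auto intro!: derivative_eq_intros)
        from has_derivative_compose[OF this, of norm "\<lambda>h. h \<bullet> sgn x"] show ?thesis
          using has_derivative_norm[OF False] by (simp add: inner_commute)
      qed
      then show ?thesis
        unfolding has_field_derivative_def
        by (rule has_derivative_eq_rhs) (simp add: sgn_div_norm inner_axis divide_inverse fun_eq_iff)
    qed
    from DERIV_fun_powr[OF this, of "2 * \<gamma>"] n
    have d: "((\<lambda>t. norm (x + t *\<^sub>R axis i 1) powr (2 * \<gamma>)) has_real_derivative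
        2 * \<gamma> * norm x powr (2 * \<gamma> - 1) * (x $ i / norm x)) (at 0)"
      by simp
    have "((\<lambda>t. x $ i + t) has_real_derivative 1) (at 0)"
      by (auto intro!: derivative_eq_intros)
    from DERIV_mult[OF d this] show ?thesis
      unfolding grushin_weight_def using \<gamma> n
      by (simp add: powr_diff power2_eq_square algebra_simps)
  qed
qed

section \<open>Second derivatives of the Kelvin transform\<close>

text \<open>Along the line the transform is a power of the gauge times \<open>u\<close> on the image
  curve, whose velocity is \<open>E + \<sigma> *\<^sub>R P\<close>; the argument of the last
  \<open>Du K\<close> is its acceleration. The direction enters through \<open>E\<close> and the
  derivatives \<open>r\<close>, \<open>r'\<close> of the gauge, so x and y directions share one
  formula.\<close>

lemma second_partial_derivative_kelvin_transform:
  fixes \<gamma> :: real and z :: "(real ^ 'n) \<times> (real ^ 'l)" and Du :: "_ \<Rightarrow> _ \<Rightarrow>\<^sub>L real"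
  defines "K \<equiv> kelvin_point \<gamma> z"
  assumes "\<gamma> \<ge> 0" "z \<noteq> 0" "open U" "K \<in> U"
    and Du: "\<And>z. z \<in> U \<Longrightarrow> (u has_derivative blinfun_apply (Du z)) (at z)"
    and D2: "(Du has_derivative blinfun_apply D2) (at K)"
    and r: "\<And>t. ((\<lambda>t. grushin_gauge \<gamma> (z + t *\<^sub>R v)) has_real_derivative r t) (at t)"
    and r': "(r has_real_derivative r') (at 0)"
    and "a = (2 - homogeneous_dim CARD('n) CARD('l) \<gamma>) / (2 + 2 * \<gamma>)"
    and "R = grushin_gauge \<gamma> z"
    and "\<sigma> = r 0 / R"
    and "\<sigma>' = r' / R - \<sigma>\<^sup>2"
    and "E = kelvin_scaling \<gamma> R v"
    and "P = kelvin_generator \<gamma> K"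
  shows "partial_derivative v (partial_derivative v (kelvin_transform \<gamma> u)) z =
    R powr a * ((a\<^sup>2 * \<sigma>\<^sup>2 + a * \<sigma>') * u K
      + 2 * a * \<sigma> * Du K (E + \<sigma> *\<^sub>R P)
      + D2 (E + \<sigma> *\<^sub>R P) (E + \<sigma> *\<^sub>R P)
      + Du K ((2 * \<sigma>) *\<^sub>R kelvin_generator \<gamma> E + \<sigma>' *\<^sub>R P + \<sigma>\<^sup>2 *\<^sub>R kelvin_generator \<gamma> P))"
proof -
  define \<rho> where "\<rho> t = grushin_gauge \<gamma> (z + t *\<^sub>R v)" for t
  define k where "k t = kelvin_scaling \<gamma> (\<rho> t) (z + t *\<^sub>R v)" for t
  define s where "s t = r t / \<rho> t" for t
  define k' where "k' t = kelvin_scaling \<gamma> (\<rho> t) v + s t *\<^sub>R kelvin_generator \<gamma> (k t)" for t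
  have \<rho>': "(\<rho> has_real_derivative r t) (at t)" for t
    unfolding \<rho>_def by (rule r)
  have line: "((\<lambda>t. z + t *\<^sub>R v) has_vector_derivative v) (at t)" for t
    by (auto intro!: derivative_eq_intros)
  have k0: "k 0 = K" and \<rho>0: "\<rho> 0 = R"
    using assms by (simp_all add: k_def \<rho>_def kelvin_point_eq)
  have R: "R > 0"
    using assms grushin_gauge_pos by blast
  have k'_deriv: "(k has_vector_derivative k' t) (at t)" if "\<rho> t > 0" for t
    unfolding k_def[abs_def] k'_def s_def
    by (rule has_vector_derivative_kelvin_scaling[OF \<rho>' that line])
  have s_deriv: "(s has_real_derivative \<sigma>') (at 0)"
    unfolding s_def[abs_def] using R \<rho>0 assms
    by (auto intro!: derivative_eq_intros r' \<rho>' simp: field_simps power2_eq_square)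
  have s0: "s 0 = \<sigma>" using assms \<rho>0 by (simp add: s_def)
  have k'0: "k' 0 = E + \<sigma> *\<^sub>R P"
    using assms s0 k0 \<rho>0 by (simp add: k'_def)
  have k''_deriv: "(k' has_vector_derivative
     (2 * \<sigma>) *\<^sub>R kelvin_generator \<gamma> E + \<sigma>' *\<^sub>R P + \<sigma>\<^sup>2 *\<^sub>R kelvin_generator \<gamma> P) (at 0)"
  proof -
    have 1: "((\<lambda>t. kelvin_scaling \<gamma> (\<rho> t) v) has_vector_derivative \<sigma> *\<^sub>R kelvin_generator \<gamma> E) (at 0)"
      using has_vector_derivative_kelvin_scaling[OF \<rho>', of 0 "\<lambda>_. v" 0 \<gamma>] R \<rho>0 assms(14) assms(12)
      by (simp add: linear_0[OF linear_kelvin_scaling])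
    have "(k has_vector_derivative E + \<sigma> *\<^sub>R P) (at 0)"
      using k'_deriv[of 0] R \<rho>0 k'0 by simp
    from bounded_linear.has_vector_derivative[OF bounded_linear_kelvin_generator[of \<gamma>] this]
    have "((\<lambda>t. kelvin_generator \<gamma> (k t)) has_vector_derivative
        kelvin_generator \<gamma> E + \<sigma> *\<^sub>R kelvin_generator \<gamma> P) (at 0)"
      by (simp add: linear_add[OF linear_kelvin_generator] linear_cmul[OF linear_kelvin_generator])
    note has_vector_derivative_add[OF 1 has_vector_derivative_scaleR[OF s_deriv this]]
    \<comment> \<open>One copy of the mixed term comes from the scaled direction and one from the
      moving point, hence the factor 2.\<close>
    moreover have "\<sigma> *\<^sub>R kelvin_generator \<gamma> E + (s 0 *\<^sub>R (kelvin_generator \<gamma> E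
        + \<sigma> *\<^sub>R kelvin_generator \<gamma> P) + \<sigma>' *\<^sub>R kelvin_generator \<gamma> (k 0)) =
      (2 * \<sigma>) *\<^sub>R kelvin_generator \<gamma> E + \<sigma>' *\<^sub>R P + \<sigma>\<^sup>2 *\<^sub>R kelvin_generator \<gamma> P"
      using assms(15) k0 s0 by (simp add: algebra_simps power2_eq_square flip: scaleR_2)
    ultimately show ?thesis
      unfolding k'_def[abs_def] by simp
  qed
  have "isCont \<rho> 0" "isCont k 0"
    using \<rho>' DERIV_isCont k'_deriv[of 0] R \<rho>0 has_vector_derivative_continuous by blast+
  then have "(\<rho> \<longlongrightarrow> R) (nhds 0)" "(k \<longlongrightarrow> K) (nhds 0)"
    using \<rho>0 k0 by (metis isCont_def tendsto_at_iff_tendsto_nhds)+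
  then have ev: "\<forall>\<^sub>F t in nhds 0. \<rho> t > 0 \<and> k t \<in> U"
    using R assms by (auto intro!: eventually_conj order_tendstoD topological_tendstoD)
  have "\<forall>\<^sub>F t in nhds 0. z + t *\<^sub>R v \<noteq> 0"
    using tendsto_line assms(3) by (rule tendsto_imp_eventually_ne)
  then have w: "\<forall>\<^sub>F t in nhds 0. kelvin_transform \<gamma> u (z + t *\<^sub>R v) = \<rho> t powr a * u (k t)"
  proof eventually_elim
    case (elim t)
    then have d: "grushin_dist0 \<gamma> (kelvin_point \<gamma> (z + t *\<^sub>R v)) = \<rho> t powr (- 1 / (2 + 2 * \<gamma>))"
      and K: "kelvin_point \<gamma> (z + t *\<^sub>R v) = k t"
      using assms(2) grushin_dist0_kelvin_point kelvin_point_eq unfolding \<rho>_def k_def by blast+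
    \<comment> \<open>The origin of \<open>a\<close>: it is the exponent \<open>Q - 2\<close> of the
      distance at the image, expressed in the gauge at the original point.\<close>
    have e: "- 1 / (2 + 2 * \<gamma>) * (homogeneous_dim CARD('n) CARD('l) \<gamma> - 2) = a"
      unfolding assms(10) by (simp add: divide_simps)
    show ?case
      unfolding kelvin_transform_def d unfolding K powr_powr e by (rule refl)
  qed
  have pw: "((\<lambda>t. \<rho> t powr a) has_real_derivative \<rho> t powr a * (a * s t)) (at t)" if "\<rho> t > 0" for t
    unfolding s_def using that
    by (auto intro!: derivative_eq_intros \<rho>' simp: powr_diff field_simps)
  have u_deriv: "((\<lambda>t. u (k t)) has_real_derivative Du (k t) (k' t)) (at t)" if "\<rho> t > 0" "k t \<in> U" for t
    using Du[OF that(2)] k'_deriv[OF that(1)] by (rule has_real_derivative_compose_curve)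
  \<comment> \<open>With the power factored out, the second differentiation again meets only its
    logarithmic derivative \<open>a * s t\<close>.\<close>
  define g where "g t = \<rho> t powr a * (a * s t * u (k t) + Du (k t) (k' t))" for t
  show ?thesis
  proof (rule second_partial_derivative_eq)
    \<comment> \<open>The formula for the transform must hold near each \<open>t\<close> close to 0,
      not just at \<open>t\<close>, for its derivative at \<open>t\<close> to be read off.\<close>
    from eventually_eventually[THEN iffD2, OF w] ev
    show "\<forall>\<^sub>F t in nhds 0. ((\<lambda>t. kelvin_transform \<gamma> u (z + t *\<^sub>R v)) has_real_derivative g t) (at t)"
    proof eventually_elim
      case (elim t)
      then have "\<rho> t > 0" "k t \<in> U" by simp_all
      from DERIV_mult[OF pw[OF this(1)] u_deriv[OF this]]
      have "((\<lambda>t. \<rho> t powr a * u (k t)) has_real_derivative g t) (at t)"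
        unfolding g_def by (rule DERIV_cong) (simp only: ring_distribs mult_ac add_ac)
      then show ?case
        using DERIV_cong_ev[OF refl elim(1) refl] by simp
    qed
    have 0: "\<rho> 0 > 0" "k 0 \<in> U" "(Du has_derivative blinfun_apply D2) (at (k 0))"
      using \<rho>0 k0 R assms by auto
    have "((\<lambda>t. a * s t * u (k t) + Du (k t) (k' t)) has_real_derivative
      (a * \<sigma>' * u (k 0) + Du (k 0) (k' 0) * (a * s 0)) + (D2 (k' 0) (k' 0) + Du (k 0)
      ((2 * \<sigma>) *\<^sub>R kelvin_generator \<gamma> E + \<sigma>' *\<^sub>R P + \<sigma>\<^sup>2 *\<^sub>R kelvin_generator \<gamma> P))) (at 0)"
      by (intro DERIV_add DERIV_mult[OF DERIV_cmult[OF s_deriv] u_deriv[OF 0(1,2)]]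
          has_real_derivative_blinfun_curve[OF 0(3) k'_deriv[OF 0(1)] k''_deriv])
    from DERIV_mult[OF pw[OF 0(1)] this]
    show "(g has_real_derivative R powr a * ((a\<^sup>2 * \<sigma>\<^sup>2 + a * \<sigma>') * u K
      + 2 * a * \<sigma> * Du K (E + \<sigma> *\<^sub>R P)
      + D2 (E + \<sigma> *\<^sub>R P) (E + \<sigma> *\<^sub>R P)
      + Du K ((2 * \<sigma>) *\<^sub>R kelvin_generator \<gamma> E + \<sigma>' *\<^sub>R P + \<sigma>\<^sup>2 *\<^sub>R kelvin_generator \<gamma> P))) (at 0)"
      unfolding g_def[abs_def] k0 \<rho>0 s0 k'0
      by (rule DERIV_cong) (simp add: algebra_simps power2_eq_square)
  qed
qed

section \<open>Weighted sums over the coordinate directions\<close>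

lemma grushin_weight_norm:
  assumes "\<gamma> \<ge> 0"
  shows "norm x powr (2 + 2 * \<gamma>) = grushin_weight \<gamma> x * (norm x)\<^sup>2"
  using assms by (cases "x = 0") (auto simp: grushin_weight_def powr_add)

lemma sum_power2_vec_nth: "(\<Sum>i\<in>UNIV. (x $ i)\<^sup>2) = (norm x)\<^sup>2" for x :: "real ^ 'n"
  unfolding power2_norm_eq_inner inner_vec_def by (simp add: power2_eq_square)

text \<open>Indexing by the sum type turns the operator into one weighted sum, so that x and y
  directions need no separate treatment.\<close>

definition grushin_direction :: "'n + 'l \<Rightarrow> (real ^ 'n) \<times> (real ^ 'l)" where
  "grushin_direction = case_sum (\<lambda>i. (axis i 1, 0)) (\<lambda>j. (0, axis j 1))"

lemma sum_UNIV_Plus: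
  fixes f :: "'n::finite + 'l::finite \<Rightarrow> 'a::comm_monoid_add"
  shows "(\<Sum>k\<in>UNIV. f k) = (\<Sum>i\<in>UNIV. f (Inl i)) + (\<Sum>j\<in>UNIV. f (Inr j))"
  by (simp add: UNIV_Plus_UNIV[symmetric] sum.Plus del: UNIV_Plus_UNIV)

lemma grushin_eq_sum:
  fixes z :: "(real ^ 'n) \<times> (real ^ 'l)"
  shows "grushin \<gamma> u z = (\<Sum>k\<in>UNIV. case_sum (\<lambda>_. 1) (\<lambda>_. grushin_weight \<gamma> (fst z)) k *
     partial_derivative (grushin_direction k) (partial_derivative (grushin_direction k) u) z)"
  by (simp add: sum_UNIV_Plus grushin_def laplacian_x_def laplacian_y_def grushin_direction_def
      sum_distrib_left)

lemma has_real_derivative_gauge_line: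
  fixes z :: "(real ^ 'n) \<times> (real ^ 'l)"
  assumes "\<gamma> \<ge> 0"
  shows "((\<lambda>t. grushin_gauge \<gamma> (z + t *\<^sub>R grushin_direction k)) has_real_derivative
    (case k of
      Inl i \<Rightarrow> 2 / (1 + \<gamma>) * (grushin_weight \<gamma> (fst z + t *\<^sub>R axis i 1) * (fst z $ i + t))
    | Inr j \<Rightarrow> 2 * (snd z $ j + t))) (at t)"
proof (cases k)
  case (Inl i)
  have "((\<lambda>t. 1 / (1 + \<gamma>)\<^sup>2 * norm (fst z + t *\<^sub>R axis i 1) powr (2 + 2 * \<gamma>) + (norm (snd z))\<^sup>2)
     has_real_derivative 1 / (1 + \<gamma>)\<^sup>2 * ((2 + 2 * \<gamma>) *
      grushin_weight \<gamma> (fst z + t *\<^sub>R axis i 1) * (fst z $ i + t)) + 0) (at t)"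
    using has_real_derivative_norm_powr_line[OF assms, of "fst z" "axis i 1" t]
    by (intro DERIV_add DERIV_const DERIV_cmult) (simp add: grushin_weight_def inner_axis)
  moreover have "1 / (1 + \<gamma>)\<^sup>2 * ((2 + 2 * \<gamma>) * c * d) + 0 = 2 / (1 + \<gamma>) * (c * d)" for c d
    using assms by (simp add: divide_simps power2_eq_square)
  ultimately show ?thesis
    unfolding Inl grushin_gauge_def grushin_direction_def by simp
next
  case (Inr j)
  have "((\<lambda>t. (snd z + t *\<^sub>R axis j 1) \<bullet> (snd z + t *\<^sub>R axis j 1)) has_real_derivative
      2 * (snd z $ j + t)) (at t)"
    unfolding has_field_derivative_def
    by (auto intro!: derivative_eq_intros simp: inner_axis inner_axis' algebra_simps fun_eq_iff)
  then show ?thesis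
    unfolding Inr grushin_gauge_def grushin_direction_def
    by (auto simp: power2_norm_eq_inner intro!: derivative_eq_intros)
qed

lemma has_real_derivative_gauge_line2:
  fixes z :: "(real ^ 'n) \<times> (real ^ 'l)"
  assumes "\<gamma> \<ge> 0"
  shows "((\<lambda>t. case k of
      Inl i \<Rightarrow> 2 / (1 + \<gamma>) * (grushin_weight \<gamma> (fst z + t *\<^sub>R axis i 1) * (fst z $ i + t))
    | Inr j \<Rightarrow> 2 * (snd z $ j + t)) has_real_derivative
    (case k of
      Inl i \<Rightarrow> 2 / (1 + \<gamma>) * (grushin_weight \<gamma> (fst z) * (1 + 2 * \<gamma> * (fst z $ i)\<^sup>2 / (norm (fst z))\<^sup>2))
    | Inr j \<Rightarrow> 2)) (at 0)"
proof (cases k)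
  case (Inl i)
  show ?thesis
    unfolding Inl sum.case by (intro DERIV_cmult has_real_derivative_weight_line assms)
next
  case (Inr j)
  then show ?thesis by (auto intro!: derivative_eq_intros)
qed

text \<open>The weighted gradient of the gauge, with components \<open>R * c k * \<sigma> k\<close>,
  equals \<open>- 2 * G\<close> times the generator at \<open>z\<close>; applying the scaling, which
  commutes with the generator, gives the third identity. Pairing it with the gradient gives
  \<open>4 * G * R\<close>, hence the first, and the second subtracts the first from the weighted
  second derivatives.\<close>

lemma grushin_sums:
  fixes z :: "(real ^ 'n) \<times> (real ^ 'l)"
  assumes "\<gamma> \<ge> 0" "z \<noteq> 0"
  defines "R \<equiv> grushin_gauge \<gamma> z" and "G \<equiv> grushin_weight \<gamma> (fst z)"
  defines "c \<equiv> case_sum (\<lambda>_::'n. 1) (\<lambda>_::'l. G)"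
    and "\<sigma> \<equiv> (\<lambda>k. (case k of Inl i \<Rightarrow> 2 / (1 + \<gamma>) * (G * fst z $ i) | Inr j \<Rightarrow> 2 * snd z $ j) / R)"
    and "r' \<equiv> (\<lambda>k. case k of Inl i \<Rightarrow> 2 / (1 + \<gamma>) * (G * (1 + 2 * \<gamma> * (fst z $ i)\<^sup>2 / (norm (fst z))\<^sup>2))
        | Inr j \<Rightarrow> 2)"
  shows "(\<Sum>k\<in>UNIV. c k * (\<sigma> k)\<^sup>2) = 4 * (G / R)"
    and "(\<Sum>k\<in>UNIV. c k * (r' k / R - (\<sigma> k)\<^sup>2)) =
      G / R * (2 / (1 + \<gamma>) * (homogeneous_dim CARD('n) CARD('l) \<gamma> - 2))"
    and "(\<Sum>k\<in>UNIV. (c k * \<sigma> k) *\<^sub>R kelvin_scaling \<gamma> R (grushin_direction k)) =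
      (- 2 * (G / R)) *\<^sub>R kelvin_generator \<gamma> (kelvin_scaling \<gamma> R z)"
proof -
  have R: "R > 0" unfolding R_def using grushin_gauge_pos assms by blast
  have R_eq: "R = G * (norm (fst z))\<^sup>2 / (1 + \<gamma>)\<^sup>2 + (norm (snd z))\<^sup>2"
    using assms by (simp add: grushin_gauge_def grushin_weight_norm)
  have "(\<Sum>k\<in>UNIV. c k * (\<sigma> k)\<^sup>2) =
      (2 / (1 + \<gamma>) * G / R)\<^sup>2 * (\<Sum>i\<in>UNIV. (fst z $ i)\<^sup>2) + G * (2 / R)\<^sup>2 * (\<Sum>j\<in>UNIV. (snd z $ j)\<^sup>2)"
    unfolding sum_UNIV_Plus c_def \<sigma>_def sum_distrib_left
    by (simp add: power_mult_distrib power_divide algebra_simps)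
  also have "\<dots> = 4 * G * R / R\<^sup>2"
    unfolding sum_power2_vec_nth by (subst (3) R_eq) (simp add: power2_eq_square algebra_simps add_divide_distrib)
  also have "\<dots> = 4 * (G / R)" using R by (simp add: power2_eq_square)
  finally show 1: "(\<Sum>k\<in>UNIV. c k * (\<sigma> k)\<^sup>2) = 4 * (G / R)" .
  have "(\<Sum>k\<in>UNIV. c k * r' k) = 2 / (1 + \<gamma>) * (G * CARD('n)
      + G * 2 * \<gamma> * (\<Sum>i\<in>UNIV. (fst z $ i)\<^sup>2) / (norm (fst z))\<^sup>2) + G * 2 * CARD('l)"
    unfolding sum_UNIV_Plus c_def r'_def
    by (simp add: sum_distrib_left sum_divide_distrib sum.distrib algebra_simps)
  \<comment> \<open>At \<open>x = 0\<close> the quotient is 0, but so is the right side: either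
    \<open>\<gamma> = 0\<close> or the weight \<open>G\<close> vanishes.\<close>
  also have "G * 2 * \<gamma> * (\<Sum>i\<in>UNIV. (fst z $ i)\<^sup>2) / (norm (fst z))\<^sup>2 = G * 2 * \<gamma>"
    unfolding sum_power2_vec_nth by (cases "fst z = 0") (auto simp: G_def grushin_weight_def)
  \<comment> \<open>The summand \<open>4 * G\<close> is split off because, divided by
    \<open>R\<close>, it is the sum of the squares.\<close>
  also have "2 / (1 + \<gamma>) * (G * CARD('n) + G * 2 * \<gamma>) + G * 2 * CARD('l) =
      G * (2 / (1 + \<gamma>) * (homogeneous_dim CARD('n) CARD('l) \<gamma> - 2)) + 4 * G"
    using assms(1) by (simp add: homogeneous_dim_def field_simps)
  finally have "(\<Sum>k\<in>UNIV. c k * r' k) / R - 4 * (G / R) =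
      G / R * (2 / (1 + \<gamma>) * (homogeneous_dim CARD('n) CARD('l) \<gamma> - 2))"
    by (simp add: add_divide_distrib)
  then show "(\<Sum>k\<in>UNIV. c k * (r' k / R - (\<sigma> k)\<^sup>2)) =
      G / R * (2 / (1 + \<gamma>) * (homogeneous_dim CARD('n) CARD('l) \<gamma> - 2))"
    unfolding 1[symmetric] by (simp add: right_diff_distrib sum_subtractf sum_divide_distrib)
  show "(\<Sum>k\<in>UNIV. (c k * \<sigma> k) *\<^sub>R kelvin_scaling \<gamma> R (grushin_direction k)) =
      (- 2 * (G / R)) *\<^sub>R kelvin_generator \<gamma> (kelvin_scaling \<gamma> R z)"
    unfolding sum_UNIV_Plus c_def \<sigma>_def
    by (simp add: kelvin_scaling_def kelvin_generator_def grushin_direction_def prod_eq_iff fst_sum snd_sum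
        vec_eq_iff axis_def if_distrib[where f="\<lambda>x. _ * x"] cong: if_cong) (simp add: mult_ac)
qed

section \<open>Summation and cancellation\<close>

theorem theorem1p3:
  fixes \<gamma> :: real
    and U :: "((real ^ 'n) \<times> (real ^ 'l)) set"
    and u :: "(real ^ 'n) \<times> (real ^ 'l) \<Rightarrow> real"
  assumes "CARD('n) + CARD('l) \<ge> 3"
    and "\<gamma> \<ge> 0"
    and "open U"
    and "U \<subseteq> UNIV - {0}"
    and "C2_on U u"
  shows "\<forall>z'. z' \<noteq> 0 \<and> kelvin_point \<gamma> z' \<in> U \<longrightarrow>
           grushin \<gamma> (kelvin_transform \<gamma> u) z' =
             grushin_dist0 \<gamma> (kelvin_point \<gamma> z') powr (homogeneous_dim CARD('n) CARD('l) \<gamma> + 2)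
               * grushin \<gamma> u (kelvin_point \<gamma> z')"
proof (intro allI impI, elim conjE)
  fix z :: "(real ^ 'n) \<times> (real ^ 'l)"
  assume z: "z \<noteq> 0" and KU: "kelvin_point \<gamma> z \<in> U"
  show "grushin \<gamma> (kelvin_transform \<gamma> u) z =
             grushin_dist0 \<gamma> (kelvin_point \<gamma> z) powr (homogeneous_dim CARD('n) CARD('l) \<gamma> + 2)
               * grushin \<gamma> u (kelvin_point \<gamma> z)"
  proof -
    obtain Du D2u where
      Du: "\<And>z. z \<in> U \<Longrightarrow> (u has_derivative blinfun_apply (Du z)) (at z)" and
      D2u: "\<And>z. z \<in> U \<Longrightarrow> (Du has_derivative blinfun_apply (D2u z)) (at z)"
      using assms(5) unfolding C2_on_def by blast
    define K where "K = kelvin_point \<gamma> z"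
    define Q where "Q = homogeneous_dim CARD('n) CARD('l) \<gamma>"
    define a where "a = (2 - Q) / (2 + 2 * \<gamma>)"
    define R where "R = grushin_gauge \<gamma> z"
    define G where "G = grushin_weight \<gamma> (fst z)"
    define h where "h = G / R"
    define c where "c = case_sum (\<lambda>_::'n. 1) (\<lambda>_::'l. G)"
    define r where "r = (\<lambda>k t. case k of
        Inl i \<Rightarrow> 2 / (1 + \<gamma>) * (grushin_weight \<gamma> (fst z + t *\<^sub>R axis i 1) * (fst z $ i + t))
      | Inr j \<Rightarrow> 2 * (snd z $ j + t))"
    define \<sigma> where "\<sigma> = (\<lambda>k. (case k of Inl i \<Rightarrow> 2 / (1 + \<gamma>) * (G * fst z $ i) | Inr j \<Rightarrow> 2 * snd z $ j) / R)"
    define r' :: "'n + 'l \<Rightarrow> real" where "r' = (\<lambda>k. case k of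
        Inl i \<Rightarrow> 2 / (1 + \<gamma>) * (G * (1 + 2 * \<gamma> * (fst z $ i)\<^sup>2 / (norm (fst z))\<^sup>2)) | Inr j \<Rightarrow> 2)"
    define \<tau> where "\<tau> = (\<lambda>k. r' k / R - (\<sigma> k)\<^sup>2)"
    define E :: "'n + 'l \<Rightarrow> (real ^ 'n) \<times> (real ^ 'l)"
      where "E = (\<lambda>k. kelvin_scaling \<gamma> R (grushin_direction k))"
    define A :: "(real ^ 'n) \<times> (real ^ 'l) \<Rightarrow> _" where "A = kelvin_generator \<gamma>"
    define P where "P = A K"
    define D where "D = blinfun_apply (Du K)"
    define B where "B = (\<lambda>v. blinfun_apply (blinfun_apply (D2u K) v))"
    have R: "R > 0" unfolding R_def using grushin_gauge_pos assms(2) z by blast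
    have KE: "K = kelvin_scaling \<gamma> R z"
      unfolding K_def R_def using kelvin_point_eq assms(2) z by blast
    have second: "partial_derivative (grushin_direction (k :: 'n + 'l))
         (partial_derivative (grushin_direction k) (kelvin_transform \<gamma> u)) z =
      R powr a * ((a\<^sup>2 * (\<sigma> k)\<^sup>2 + a * \<tau> k) * u K
      + 2 * a * \<sigma> k * D (E k + \<sigma> k *\<^sub>R P)
      + B (E k + \<sigma> k *\<^sub>R P) (E k + \<sigma> k *\<^sub>R P)
      + D ((2 * \<sigma> k) *\<^sub>R A (E k) + \<tau> k *\<^sub>R P + (\<sigma> k)\<^sup>2 *\<^sub>R A P))" for k
      unfolding D_def B_def A_def K_def
    proof (rule second_partial_derivative_kelvin_transform[where r="r k" and r'="r' k" and U=U and Du=Du])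
      show "((\<lambda>t. grushin_gauge \<gamma> (z + t *\<^sub>R grushin_direction k)) has_real_derivative r k t) (at t)" for t
        unfolding r_def by (rule has_real_derivative_gauge_line[OF assms(2)])
      show "(r k has_real_derivative r' k) (at 0)"
        unfolding r_def r'_def G_def by (rule has_real_derivative_gauge_line2[OF assms(2)])
      show "\<sigma> k = r k 0 / R"
        by (cases k) (simp_all add: \<sigma>_def r_def G_def)
      show "\<tau> k = r' k / R - (\<sigma> k)\<^sup>2"
        unfolding \<tau>_def ..
      show "a = (2 - homogeneous_dim CARD('n) CARD('l) \<gamma>) / (2 + 2 * \<gamma>)"
        unfolding a_def Q_def ..
      show "E k = kelvin_scaling \<gamma> R (grushin_direction k)"
        unfolding E_def ..
      show "P = kelvin_generator \<gamma> (kelvin_point \<gamma> z)"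
        unfolding P_def A_def K_def ..
    qed (use assms(2,3) z KU Du D2u R_def in auto)
    note sums = grushin_sums[OF assms(2) z]
    have c\<sigma>2: "(\<Sum>k\<in>UNIV. c k * (\<sigma> k)\<^sup>2) = 4 * h"
      using sums(1) unfolding c_def \<sigma>_def h_def G_def R_def .
    have c\<tau>: "(\<Sum>k\<in>UNIV. c k * \<tau> k) = - 4 * a * h"
    proof -
      have "2 / (1 + \<gamma>) * (Q - 2) = - 4 * a" unfolding a_def using assms(2) by (simp add: field_simps)
      then show ?thesis
        using sums(2) unfolding c_def \<tau>_def r'_def \<sigma>_def h_def G_def R_def Q_def by simp
    qed
    have cE: "(\<Sum>k\<in>UNIV. (c k * \<sigma> k) *\<^sub>R E k) = (- 2 * h) *\<^sub>R P"
      using sums(3) unfolding c_def \<sigma>_def h_def G_def R_def E_def P_def A_def KE .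
    \<comment> \<open>Every term linear in \<open>E k\<close> collapses to a multiple of its value
      at \<open>P\<close>. This is applied to \<open>D\<close>, to \<open>D\<close> after
      \<open>A\<close>, and to \<open>B\<close> in each argument with \<open>P\<close> in the
      other.\<close>
    have lin: "(\<Sum>k\<in>UNIV. c k * \<sigma> k * f (E k)) = - 2 * h * f P" if "linear f" for f :: "_ \<Rightarrow> real"
    proof -
      have "(\<Sum>k\<in>UNIV. c k * \<sigma> k * f (E k)) = f (\<Sum>k\<in>UNIV. (c k * \<sigma> k) *\<^sub>R E k)"
        by (simp add: linear_sum[OF that] linear_cmul[OF that])
      then show ?thesis by (simp add: cE linear_cmul[OF that] linear_neg[OF that])
    qed
    have linA: "linear A" unfolding A_def by (rule linear_kelvin_generator)
    have linD: "linear D" unfolding D_def by (intro bounded_linear.linear blinfun.bounded_linear_right)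
    have linB1: "linear (\<lambda>v. B v w)" and linB2: "linear (B w)" for w
      unfolding B_def
      by (rule linearI; simp add: blinfun.add_left blinfun.add_right blinfun.scaleR_left blinfun.scaleR_right)+
    have linDA: "linear (\<lambda>v. D (A v))"
      using linear_compose[OF linA linD] by (simp add: o_def)
    have cBE: "(\<Sum>k\<in>UNIV. c k * B (E k) (E k)) = R powr (- 2 / (1 + \<gamma>)) * grushin \<gamma> u K"
    proof -
      have B: "partial_derivative v (partial_derivative v u) K = B v v" for v
        unfolding B_def K_def using assms(3) KU Du D2u[OF KU] by (rule second_partial_derivative_C2)
      have EI: "E (Inl i) = R powr (- 1 / (1 + \<gamma>)) *\<^sub>R grushin_direction (Inl i)"
        and EJ: "E (Inr j) = (1 / R) *\<^sub>R grushin_direction (Inr j)" for i j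
        by (simp_all add: E_def kelvin_scaling_def grushin_direction_def)
      have "R powr (- 1 / (1 + \<gamma>)) * R powr (- 1 / (1 + \<gamma>)) = R powr (- 2 / (1 + \<gamma>))"
        by (simp flip: powr_add)
      then have "c (Inl i) * B (E (Inl i)) (E (Inl i)) =
          R powr (- 2 / (1 + \<gamma>)) * B (grushin_direction (Inl i)) (grushin_direction (Inl i))" for i
        by (simp add: c_def EI linear_cmul[OF linB1] linear_cmul[OF linB2])
      \<comment> \<open>Here the weight at \<open>z\<close> is exchanged for the weight at the image
        point.\<close>
      moreover have "c (Inr j) * B (E (Inr j)) (E (Inr j)) = R powr (- 2 / (1 + \<gamma>)) *
          (grushin_weight \<gamma> (fst K) * B (grushin_direction (Inr j)) (grushin_direction (Inr j)))" for j
        using grushin_weight_kelvin_scaling[OF assms(2) R, of z]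
        by (simp add: c_def EJ linear_cmul[OF linB1] linear_cmul[OF linB2] KE G_def power2_eq_square
            flip: mult.assoc)
      ultimately show ?thesis
        by (simp add: grushin_eq_sum sum_UNIV_Plus B sum_distrib_left distrib_left)
    qed
    \<comment> \<open>Expanded so that each summand is a constant times a quantity whose sum is
      known, apart from \<open>c k * B (E k) (E k)\<close>.\<close>
    have "grushin \<gamma> (kelvin_transform \<gamma> u) z = (\<Sum>k\<in>UNIV. R powr a * (
        u K * a\<^sup>2 * (c k * (\<sigma> k)\<^sup>2) + u K * a * (c k * \<tau> k)
      + 2 * a * (c k * \<sigma> k * D (E k)) + 2 * a * D P * (c k * (\<sigma> k)\<^sup>2)
      + c k * B (E k) (E k) + c k * \<sigma> k * B (E k) P + c k * \<sigma> k * B P (E k) + B P P * (c k * (\<sigma> k)\<^sup>2)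
      + 2 * (c k * \<sigma> k * D (A (E k))) + D P * (c k * \<tau> k) + D (A P) * (c k * (\<sigma> k)\<^sup>2)))"
      unfolding grushin_eq_sum second c_def[unfolded G_def, symmetric]
      by (intro sum.cong refl) (simp add: linear_add[OF linD] linear_cmul[OF linD] linear_add[OF linB1]
          linear_cmul[OF linB1] linear_add[OF linB2] linear_cmul[OF linB2] algebra_simps power2_eq_square)
    \<comment> \<open>In units of \<open>h\<close> the coefficients cancel:
      \<open>4 * a\<^sup>2 - 4 * a\<^sup>2\<close> for \<open>u K\<close>,
      \<open>- 4 * a + 8 * a - 4 * a\<close> for \<open>D P\<close>, \<open>- 2 - 2 + 4\<close> for
      \<open>B P P\<close> and \<open>- 4 + 4\<close> for \<open>D (A P)\<close>.\<close>
    also have "\<dots> = R powr a * (\<Sum>k\<in>UNIV. c k * B (E k) (E k))"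
      unfolding sum_distrib_left[symmetric] sum.distrib c\<sigma>2 c\<tau> lin[OF linD] lin[OF linB1]
        lin[OF linB2] lin[OF linDA]
      by (simp add: algebra_simps power2_eq_square)
    also have "\<dots> = R powr (a + - 2 / (1 + \<gamma>)) * grushin \<gamma> u K"
      unfolding cBE powr_add by simp
    \<comment> \<open>The Hessian lowers the exponent from \<open>a\<close> by
      \<open>2 / (1 + \<gamma>)\<close>, which turns \<open>Q - 2\<close> into \<open>Q + 2\<close>
      as a power of the distance at the image.\<close>
    also have "a + - 2 / (1 + \<gamma>) = - 1 / (2 + 2 * \<gamma>) * (Q + 2)"
      unfolding a_def using assms(2) by (simp add: divide_simps) (simp add: algebra_simps)
    also have "R powr \<dots> = grushin_dist0 \<gamma> K powr (Q + 2)"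
      unfolding K_def grushin_dist0_kelvin_point[OF assms(2) z] powr_powr R_def ..
    finally show ?thesis
      unfolding K_def Q_def .
  qed
qed

end
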